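(* Let $1\le k\le n-1$. The noncommutative symmetric function $\widetilde D_{n,k}=\widetilde X_{P_n}-\widetilde X_{P_{n-k}}\widetilde A_k$ is $\Lambda$-positive, i.e., all its coefficients in the basis $\{\Lambda^I\}$ are nonnegative. As a consequence, the symmetric function $D_{n,k}=X_{P_n}-X_{P_{n-k}}A_k$ is $e$-positive.
   Context: $\mathrm{NSym}=\mathbb{Q}\langle\Lambda_1,\Lambda_2,\dots\rangle$ is the free associative algebra on noncommuting $\Lambda_k$; for a composition $I=(i_1,\dots,i_l)$, $\Lambda^I=\Lambda_{i_1}\cdots\Lambda_{i_l}$, and these form a basis. Define $\widetilde X_{P_m}=\sum_{I=(i_1,\dots,i_l)\vDash m}i_1(i_2-1)\cdots(i_l-1)\Lambda^I$ and $\widetilde A_m=\sum_{I=(i_1,\dots,i_l)\vDash m}(i_1-1)\cdots(i_l-1)\Lambda^I$. $X_{P_m}$ is the chromatic symmetric function of the path on $m$ vertices ($X_G=\sum_c\prod_vx_{c(v)}$ over proper colorings $c\colon V(G)\to\{1,2,\dots\}$). Writing $X_{P_m}=\sum_{\lambda\vdash m}c_\lambda e_\lambda$, let $B_m=\sum_{\lambda:\,1\notin\lambda}c_\lambda e_\lambda$ and define $A_{m-1}$ by $X_{P_m}=e_1A_{m-1}+B_m$. A symmetric function is $e$-positive if all its coefficients in the elementary basis $\{e_\lambda\}$ are nonnegative. *)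

theory Defs
  imports Complex_Main "HOL-Library.Multiset" "HOL-Library.Poly_Mapping" "HOL-Library.FuncSet"
begin

section \<open>Noncommutative symmetric functions\<close>

typedef composition = "{is :: nat list. 0 \<notin> set is}"
  morphisms parts Composition
  by (rule exI[of _ "[]"]) simp

setup_lifting type_definition_composition

text \<open>Compositions under concatenation are the free monoid on the positive integers, so the
  convolution ring of finitely supported functions on them is the free associative algebra on
  generators indexed by the positive integers.\<close>

instantiation composition :: monoid_add
begin

lift_definition zero_composition :: composition is "[]" by simp

lift_definition plus_composition :: "composition \<Rightarrow> composition \<Rightarrow> composition" is "(@)"
  by simp

instance
  by standard (transfer, simp)+

end

type_synonym nsym = "composition \<Rightarrow>\<^sub>0 rat"

definition Lambda :: "nat \<Rightarrow> nsym" where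
  "Lambda k = Poly_Mapping.single (Composition [k]) 1"

definition Lambda_comp :: "composition \<Rightarrow> nsym" where
  "Lambda_comp I = prod_list (map Lambda (parts I))"

lemma Lambda_comp_eq_single: "Lambda_comp I = Poly_Mapping.single I 1"
proof -
  have "prod_list (map Lambda xs) = Poly_Mapping.single (Composition xs) 1"
    if "0 \<notin> set xs" for xs
    using that
  proof (induction xs)
    case Nil
    then show ?case by (simp flip: zero_composition_def)
  next
    case (Cons x xs)
    then have "Composition [x] + Composition xs = Composition (x # xs)"
      by (intro parts_inject[THEN iffD1])
        (auto simp: plus_composition.rep_eq Composition_inverse)
    with Cons show ?case by (simp add: Lambda_def mult_single)
  qed
  then show ?thesis
    using parts[of I] by (simp add: Lambda_comp_def parts_inverse)
qed

text \<open>Hence the coefficient of a composition-indexed basis element is given by \<open>lookup\<close>.\<close>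

lemma nsym_expansion:
  "f = (\<Sum>I\<in>Poly_Mapping.keys f. Poly_Mapping.single 0 (Poly_Mapping.lookup f I) * Lambda_comp I)"
  by (rule poly_mapping_eqI)
    (auto simp: Lambda_comp_eq_single mult_single lookup_sum lookup_single when_def in_keys_iff)

definition Lambda_positive :: "nsym \<Rightarrow> bool" where
  "Lambda_positive f \<longleftrightarrow> (\<forall>I. 0 \<le> Poly_Mapping.lookup f I)"

definition compositions_of :: "nat \<Rightarrow> composition set" where
  "compositions_of m = {I. sum_list (parts I) = m}"

text \<open>The empty composition, relevant only for \<open>m = 0\<close>, has weight \<open>1\<close>.\<close>

definition path_weight :: "composition \<Rightarrow> int" where
  "path_weight I = (case parts I of [] \<Rightarrow> 1 | i # is \<Rightarrow> int i * (\<Prod>j\<leftarrow>is. int j - 1))"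

definition X_path_nc :: "nat \<Rightarrow> nsym" where
  "X_path_nc m = (\<Sum>I\<in>compositions_of m. of_int (path_weight I) * Lambda_comp I)"

definition A_nc :: "nat \<Rightarrow> nsym" where
  "A_nc m = (\<Sum>I\<in>compositions_of m. of_int (\<Prod>i\<leftarrow>parts I. int i - 1) * Lambda_comp I)"

definition D_nc :: "nat \<Rightarrow> nat \<Rightarrow> nsym" where
  "D_nc n k = X_path_nc n - X_path_nc (n - k) * A_nc k"


section \<open>Formal power series in infinitely many commuting variables\<close>

text \<open>A multiset of indices stands for the product of the corresponding variables.\<close>

typedef series = "UNIV :: (nat multiset \<Rightarrow> rat) set"
  morphisms coeff Series ..

setup_lifting type_definition_series

lemma finite_submultisets: "finite {A. A \<subseteq># M}" for M :: "'a multiset"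
proof (induction M)
  case empty
  then show ?case by simp
next
  case (add x M)
  have "{A. A \<subseteq># add_mset x M} \<subseteq> {A. A \<subseteq># M} \<union> add_mset x ` {A. A \<subseteq># M}"
  proof
    fix A assume A: "A \<in> {A. A \<subseteq># add_mset x M}"
    show "A \<in> {A. A \<subseteq># M} \<union> add_mset x ` {A. A \<subseteq># M}"
    proof (cases "x \<in># A")
      case True
      then obtain B where "A = add_mset x B" by (metis mset_add)
      then show ?thesis using A by auto
    next
      case False
      then show ?thesis using A
        by (auto simp: subseteq_mset_def not_in_iff split: if_splits) (metis le0)
    qed
  qed
  then show ?case using add finite_subset by blast
qed

lemma finite_splittings: "finite {(A, B). A + B = M}" for M :: "'a multiset"
proof (rule finite_subset)
  show "{(A, B). A + B = M} \<subseteq> {A. A \<subseteq># M} \<times> {A. A \<subseteq># M}" by auto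
qed (simp add: finite_submultisets)

instantiation series :: comm_ring_1
begin

lift_definition zero_series :: series is "\<lambda>_. 0" .
lift_definition one_series :: series is "\<lambda>M. if M = {#} then 1 else 0" .
lift_definition plus_series :: "series \<Rightarrow> series \<Rightarrow> series" is "\<lambda>f g M. f M + g M" .
lift_definition uminus_series :: "series \<Rightarrow> series" is "\<lambda>f M. - f M" .
lift_definition minus_series :: "series \<Rightarrow> series \<Rightarrow> series" is "\<lambda>f g M. f M - g M" .
lift_definition times_series :: "series \<Rightarrow> series \<Rightarrow> series" is
  "\<lambda>f g M. \<Sum>(A, B)\<in>{(A, B). A + B = M}. f A * g B" .

instance
proof
  fix f g h :: series
  show "f * g * h = f * (g * h)"
  proof (transfer, rule ext)
    fix f g h :: "nat multiset \<Rightarrow> rat" and M :: "nat multiset"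
    have "(\<Sum>(P, C)\<in>{(P, C). P + C = M}. (\<Sum>(A, B)\<in>{(A, B). A + B = P}. f A * g B) * h C)
        = (\<Sum>(P, Q)\<in>Sigma {(P, C). P + C = M} (\<lambda>P. {(A, B). A + B = fst P}).
            f (fst Q) * g (snd Q) * h (snd P))"
      by (subst sum.Sigma[symmetric])
        (auto simp: finite_splittings sum_distrib_right case_prod_beta)
    also have "\<dots> = (\<Sum>(P, Q)\<in>Sigma {(A, P). A + P = M} (\<lambda>P. {(B, C). B + C = snd P}).
            f (fst P) * (g (fst Q) * h (snd Q)))"
      by (rule sum.reindex_bij_witness
            [where j = "\<lambda>(P, Q). ((fst Q, snd Q + snd P), (snd Q, snd P))"
              and i = "\<lambda>(P, Q). ((fst P + fst Q, snd Q), (fst P, fst Q))"])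
        (auto simp: add.assoc mult.assoc)
    also have "\<dots> = (\<Sum>(A, P)\<in>{(A, P). A + P = M}. f A * (\<Sum>(B, C)\<in>{(B, C). B + C = P}. g B * h C))"
      by (subst sum.Sigma[symmetric])
        (auto simp: finite_splittings sum_distrib_left case_prod_beta)
    finally show "(\<Sum>(P, C)\<in>{(P, C). P + C = M}. (\<Sum>(A, B)\<in>{(A, B). A + B = P}. f A * g B) * h C)
        = (\<Sum>(A, P)\<in>{(A, P). A + P = M}. f A * (\<Sum>(B, C)\<in>{(B, C). B + C = P}. g B * h C))" .
  qed
  show "f * g = g * f"
  proof (transfer, rule ext)
    fix f g :: "nat multiset \<Rightarrow> rat" and M :: "nat multiset"
    show "(\<Sum>(A, B)\<in>{(A, B). A + B = M}. f A * g B) = (\<Sum>(A, B)\<in>{(A, B). A + B = M}. g A * f B)"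
      by (rule sum.reindex_bij_witness[where i = prod.swap and j = prod.swap])
        (auto simp: add.commute mult.commute)
  qed
  show "1 * f = f"
  proof (transfer, rule ext)
    fix f :: "nat multiset \<Rightarrow> rat" and M :: "nat multiset"
    have "(\<Sum>(A, B)\<in>{(A, B). A + B = M}. (if A = {#} then 1 else 0) * f B)
        = (\<Sum>(A, B)\<in>{({#} :: nat multiset, M)}. (if A = {#} then 1 else 0) * f B)"
      by (rule sum.mono_neutral_right) (auto simp: finite_splittings split: if_splits)
    then show "(\<Sum>(A, B)\<in>{(A, B). A + B = M}. (if A = {#} then 1 else 0) * f B) = f M"
      by simp
  qed
  show "(f + g) * h = f * h + g * h"
    by transfer (simp add: fun_eq_iff case_prod_beta distrib_right sum.distrib)
  show "(0::series) \<noteq> 1"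
    by transfer (metis zero_neq_one)
qed (transfer; simp add: fun_eq_iff)+

end

lift_definition scale :: "rat \<Rightarrow> series \<Rightarrow> series" is "\<lambda>c f M. c * f M" .

global_interpretation series: vector_space scale
  by standard (transfer; simp add: fun_eq_iff algebra_simps)+


section \<open>Elementary symmetric functions and e-positivity\<close>

text \<open>The variables are \<open>x\<^sub>1, x\<^sub>2, \<dots>\<close>; the index \<open>0\<close> is never used.\<close>

definition elem :: "nat \<Rightarrow> series" where
  "elem k = Series (\<lambda>M. if M \<in> mset_set ` {S. finite S \<and> S \<subseteq> {1..} \<and> card S = k} then 1 else 0)"

text \<open>Integer partitions are multisets of positive integers.\<close>

definition partitions_of :: "nat \<Rightarrow> nat multiset set" where
  "partitions_of m = {\<mu>. 0 \<notin># \<mu> \<and> sum_mset \<mu> = m}"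

definition elem_part :: "nat multiset \<Rightarrow> series" where
  "elem_part \<mu> = (\<Prod>k\<in>#\<mu>. elem k)"

definition elem_basis :: "series set" where
  "elem_basis = elem_part ` {\<mu>. 0 \<notin># \<mu>}"

definition elem_coeff :: "series \<Rightarrow> nat multiset \<Rightarrow> rat" where
  "elem_coeff f \<mu> = series.representation elem_basis f (elem_part \<mu>)"

definition e_positive :: "series \<Rightarrow> bool" where
  "e_positive f \<longleftrightarrow> f \<in> series.span elem_basis \<and> (\<forall>\<mu>. 0 \<notin># \<mu> \<longrightarrow> 0 \<le> elem_coeff f \<mu>)"


section \<open>Chromatic symmetric functions\<close>

text \<open>A graph is given by its vertex set and its set of (two-element) edges. Colorings are made
  extensional so that each function on the vertex set is counted once.\<close>

definition proper_colorings :: "'v set \<Rightarrow> 'v set set \<Rightarrow> ('v \<Rightarrow> nat) set" where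
  "proper_colorings V E =
    {c \<in> V \<rightarrow>\<^sub>E {1..}. \<forall>u v. {u, v} \<in> E \<longrightarrow> c u \<noteq> c v}"

definition chromatic :: "'v set \<Rightarrow> 'v set set \<Rightarrow> series" where
  "chromatic V E =
    Series (\<lambda>M. of_nat (card {c \<in> proper_colorings V E. image_mset c (mset_set V) = M}))"

definition X_path :: "nat \<Rightarrow> series" where
  "X_path m = chromatic {1..m} {{i, i + 1} | i. 1 \<le> i \<and> i < m}"

definition B_path :: "nat \<Rightarrow> series" where
  "B_path m = (\<Sum>\<mu>\<in>{\<mu>\<in>partitions_of m. 1 \<notin># \<mu>}. scale (elem_coeff (X_path m) \<mu>) (elem_part \<mu>))"

definition A_path :: "nat \<Rightarrow> series" where
  "A_path m = (THE a. X_path (m + 1) = elem 1 * a + B_path (m + 1))"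

definition D_path :: "nat \<Rightarrow> nat \<Rightarrow> series" where
  "D_path n k = X_path n - X_path (n - k) * A_path k"

end

theory Submission
  imports Defs "HOL-Library.Multiset_Order" "HOL-Computational_Algebra.Formal_Power_Series"
begin

text \<open>A composition of \<open>n\<close> splits in at most one way into compositions of \<open>n - k\<close> and \<open>k\<close>, and
  the weights multiply under such a splitting, so subtracting the product from \<open>X_path_nc n\<close> just
  removes the splittable compositions.  The commutative claim follows by applying the ring
  homomorphism \<open>\<Lambda>\<^sub>i \<mapsto> e\<^sub>i\<close>.  That it sends \<open>X_path_nc n\<close> to \<open>X_path n\<close> rests on the identity
  \<open>\<Sum>\<^sub>i e\<^sub>i X\<^sub>n\<^sub>-\<^sub>i = e\<^sub>n + \<Sum>\<^sub>i i e\<^sub>i X\<^sub>n\<^sub>-\<^sub>i\<close>, proved by a bijection on pairs of a set of colors and a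
  word without equal neighbours.  That it sends \<open>A_nc k\<close> to \<open>A_path k\<close> needs the linear
  independence of the elementary basis and the cancellability of \<open>e\<^sub>1\<close>.\<close>

section \<open>Coefficients of series\<close>

lemma coeff_Series [simp]: "coeff (Series f) = f"
  by (simp add: Series_inverse)

lemma series_eqI: "(\<And>M. coeff f M = coeff g M) \<Longrightarrow> f = g"
  by (simp add: coeff_inject[symmetric] fun_eq_iff)

lemma coeff_sum: "coeff (sum f A) M = (\<Sum>a\<in>A. coeff (f a) M)"
  by (induction A rule: infinite_finite_induct)
    (simp_all add: zero_series.rep_eq plus_series.rep_eq)

lemma scale_mult_left: "scale c f * g = scale c (f * g)"
  by (rule series_eqI)
    (simp add: times_series.rep_eq scale.rep_eq sum_distrib_left case_prod_beta mult.assoc)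

lemma scale_mult_scale: "scale c f * scale d g = scale (c * d) (f * g)"
  by (metis scale_mult_left mult.commute series.scale_scale)

lemma scale_of_nat: "scale (of_nat n) f = of_nat n * f"
  by (induction n) (simp_all add: series.scale_left_distrib distrib_right)

lemma scale_of_int: "scale (of_int z) f = of_int z * f"
  by (cases z rule: int_diff_cases)
    (simp add: scale_of_nat series.scale_left_diff_distrib left_diff_distrib)


section \<open>Linear independence of the elementary basis\<close>

text \<open>The multiset order is a monomial order in which \<open>x\<^sub>1 \<cdots> x\<^sub>k\<close> is the least monomial of
  \<open>elem k\<close>.\<close>

definition least_term :: "series \<Rightarrow> nat multiset \<Rightarrow> rat \<Rightarrow> bool" where
  "least_term f M c \<longleftrightarrow> coeff f M = c \<and> (\<forall>N<M. coeff f N = 0)"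

text \<open>Addition of multisets is strictly monotone for this linear order. So
  \<open>M + N\<close> splits into factors that are not below \<open>M\<close> and \<open>N\<close>
  only as the pair \<open>(M, N)\<close> itself.\<close>

lemma least_term_mult:
  assumes f: "least_term f M c" and g: "least_term g N d"
  shows "least_term (f * g) (M + N) (c * d)"
proof -
  have zero: "coeff f A * coeff g B = 0" if "A < M \<or> B < N" for A B
    using that f g by (auto simp: least_term_def)
  have less: "A < M \<or> B < N" if "A + B = M + N" "(A, B) \<noteq> (M, N)" for A B
  proof (rule ccontr)
    assume "\<not> (A < M \<or> B < N)"
    then have "M \<le> A" "N \<le> B" by auto
    moreover from this that have "M < A \<or> N < B" by auto
    ultimately have "M + N < A + B"
      using add_less_le_mono[of M A N B] add_le_less_mono[of M A N B] by blast
    with that show False by simp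
  qed
  have "coeff (f * g) (M + N) = (\<Sum>(A, B)\<in>{(M, N)}. coeff f A * coeff g B)"
    unfolding times_series.rep_eq
    by (rule sum.mono_neutral_right) (use less zero in \<open>force simp: finite_splittings\<close>)+
  moreover have "coeff (f * g) L = 0" if "L < M + N" for L
    unfolding times_series.rep_eq
  proof (rule sum.neutral, clarify)
    fix A B assume "L = A + B"
    with that have "A < M \<or> B < N"
      using add_mono[of M A N B] by (meson not_less)
    then show "coeff f A * coeff g B = 0" by (rule zero)
  qed
  ultimately show ?thesis
    using f g by (simp add: least_term_def)
qed

text \<open>A set \<open>S\<close> of size \<open>k\<close> other than \<open>{1..k}\<close> has an
  element above \<open>k\<close>. That element exceeds every member of \<open>{1..k}\<close> missing
  from \<open>S\<close>, which is the witness the Huet-Oppen form of the multiset order asks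
  for.\<close>

lemma mset_set_atLeastAtMost_le:
  assumes "finite S" "S \<subseteq> {1..}" "card S = k"
  shows "mset_set {1..k} \<le> mset_set S"
proof (cases "S = {1..k}")
  case False
  have "\<exists>x>y. x \<in> S \<and> x \<notin> {1..k}" if "y \<in> {1..k}" "y \<notin> S" for y
  proof -
    have "\<not> S \<subseteq> {1..k}"
      using card_subset_eq[of "{1..k}" S] assms False by auto
    then show ?thesis using that assms by force
  qed
  then have "mset_set {1..k} < mset_set S"
    using assms(1) False
    by (auto simp: less_multiset\<^sub>H\<^sub>O count_mset_set' mset_set_eq_iff)
  then show ?thesis by simp
qed simp

lemma least_term_elem: "least_term (elem k) (mset_set {1..k}) 1"
proof -
  have "coeff (elem k) N = 0" if "N < mset_set {1..k}" for N
    using that mset_set_atLeastAtMost_le[of _ k] by (force simp: elem_def)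
  then show ?thesis
    by (auto simp: least_term_def elem_def intro!: imageI)
qed

lemma least_term_elem_part: "least_term (elem_part \<mu>) (\<Sum>k\<in>#\<mu>. mset_set {1..k}) 1"
proof (induction \<mu>)
  case empty
  show ?case
    by (auto simp: least_term_def elem_part_def one_series.rep_eq)
next
  case (add k \<mu>)
  then show ?case
    using least_term_mult[OF least_term_elem add] by (simp add: elem_part_def)
qed

text \<open>The least monomial of \<open>elem_part \<mu>\<close> thus has the conjugate partition of
  \<open>\<mu>\<close> as its exponent vector.\<close>

lemma count_sum_mset_intervals:
  "count (\<Sum>k\<in>#\<mu>. mset_set {1..k}) (Suc j) = size {#k \<in># \<mu>. j < k#}"
  by (induction \<mu>) (auto simp: count_mset_set')

text \<open>A partition is recovered from its conjugate: multiplicities are differences of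
  consecutive exponents. A part 0 would leave no trace in the exponents.\<close>

lemma sum_mset_intervals_inject:
  fixes \<mu> \<nu> :: "nat multiset"
  assumes "0 \<notin># \<mu>" "0 \<notin># \<nu>"
    and eq: "(\<Sum>k\<in>#\<mu>. mset_set {1..k}) = (\<Sum>k\<in>#\<nu>. mset_set {1..k})"
  shows "\<mu> = \<nu>"
proof (rule multiset_eqI)
  have split: "size {#k \<in># \<rho>. j < k#} = count \<rho> (Suc j) + size {#k \<in># \<rho>. Suc j < k#}" for \<rho> j
    by (induction \<rho>) auto
  have "size {#k \<in># \<mu>. j < k#} = size {#k \<in># \<nu>. j < k#}" for j
    using arg_cong[OF eq, of "\<lambda>M. count M (Suc j)"] by (simp only: count_sum_mset_intervals)
  then have "count \<mu> (Suc j) = count \<nu> (Suc j)" for j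
    using split[of j \<mu>] split[of j \<nu>] by simp
  then show "count \<mu> i = count \<nu> i" for i
    using assms(1,2) by (cases i) (simp_all add: not_in_iff)
qed

text \<open>Triangularity: distinct partitions have distinct least monomials. Among the terms with
  nonzero coefficient, the smallest of these monomials therefore occurs in one term only and cannot
  cancel.\<close>

lemma elem_part_combination_eq_0:
  assumes "finite T" "\<And>\<mu>. \<mu> \<in> T \<Longrightarrow> 0 \<notin># \<mu>"
    and comb: "(\<Sum>\<mu>\<in>T. scale (c \<mu>) (elem_part \<mu>)) = 0" and "\<nu> \<in> T"
  shows "c \<nu> = 0"
proof (rule ccontr)
  define low where "low \<mu> = (\<Sum>k\<in>#\<mu>. mset_set {1..k})" for \<mu> :: "nat multiset"
  assume "c \<nu> \<noteq> 0"
  define U where "U = {\<mu> \<in> T. c \<mu> \<noteq> 0}"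
  have "finite U" "U \<noteq> {}"
    using assms \<open>c \<nu> \<noteq> 0\<close> by (auto simp: U_def)
  then obtain \<mu> where \<mu>: "\<mu> \<in> U" "\<And>\<rho>. \<rho> \<in> U \<Longrightarrow> low \<mu> \<le> low \<rho>"
    using ex_is_arg_min_if_finite[of U low] by (auto simp: is_arg_min_linorder)
  have "c \<rho> * coeff (elem_part \<rho>) (low \<mu>) = (if \<rho> = \<mu> then c \<mu> else 0)" if "\<rho> \<in> T" for \<rho>
  proof (cases "\<rho> = \<mu> \<or> c \<rho> = 0")
    case True
    then show ?thesis
      using least_term_elem_part[of \<mu>] \<mu> by (auto simp: least_term_def low_def U_def)
  next
    case False
    then have "low \<mu> \<le> low \<rho>" "low \<mu> \<noteq> low \<rho>"
      using \<mu> that assms(2) sum_mset_intervals_inject[of \<mu> \<rho>] by (auto simp: U_def low_def)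
    then show ?thesis
      using least_term_elem_part[of \<rho>] False by (auto simp: least_term_def low_def)
  qed
  then have "coeff (\<Sum>\<mu>\<in>T. scale (c \<mu>) (elem_part \<mu>)) (low \<mu>) = (\<Sum>\<rho>\<in>T. if \<rho> = \<mu> then c \<mu> else 0)"
    by (simp add: coeff_sum scale.rep_eq)
  also have "\<dots> = c \<mu>"
    using \<mu> assms(1) by (simp add: U_def)
  finally show False
    using \<mu> by (simp add: comb zero_series.rep_eq U_def)
qed

lemma inj_on_elem_part: "inj_on elem_part {\<mu>. 0 \<notin># \<mu>}"
proof (rule inj_onI, rule ccontr)
  fix \<mu> \<nu> assume *: "\<mu> \<in> {\<mu>. 0 \<notin># \<mu>}" "\<nu> \<in> {\<mu>. 0 \<notin># \<mu>}" "elem_part \<mu> = elem_part \<nu>" "\<mu> \<noteq> \<nu>"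
  then show False
    \<comment> \<open>Equality would give the nontrivial relation
      \<open>elem_part \<mu> - elem_part \<nu> = 0\<close>.\<close>
    using elem_part_combination_eq_0[of "{\<mu>, \<nu>}" "\<lambda>\<rho>. if \<rho> = \<mu> then 1 else - 1" \<mu>] by auto
qed

lemma independent_elem_basis: "series.independent elem_basis"
proof
  assume "series.dependent elem_basis"
  then obtain t u v where t: "finite t" "t \<subseteq> elem_basis" "(\<Sum>v\<in>t. scale (u v) v) = 0"
    "v \<in> t" "u v \<noteq> 0"
    unfolding series.dependent_explicit by blast
  then obtain T where T: "T \<subseteq> {\<mu>. 0 \<notin># \<mu>}" "t = elem_part ` T"
    unfolding elem_basis_def by (meson subset_imageE)
  then have inj: "inj_on elem_part T"
    using inj_on_elem_part inj_on_subset by blast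
  have "finite T"
    using t T inj by (simp add: finite_image_iff)
  moreover have "(\<Sum>\<mu>\<in>T. scale (u (elem_part \<mu>)) (elem_part \<mu>)) = 0"
    using t inj by (simp add: T sum.reindex)
  ultimately show False
    using elem_part_combination_eq_0[of T "\<lambda>\<mu>. u (elem_part \<mu>)"] t T by auto
qed

lemma elem_part_in_span: "0 \<notin># \<mu> \<Longrightarrow> elem_part \<mu> \<in> series.span elem_basis"
  by (auto simp: elem_basis_def intro!: series.span_base)

text \<open>Reads off coefficients from sums indexed by compositions; \<open>g\<close> may be
  non-injective, since several compositions rearrange to one partition.\<close>

lemma elem_coeff_sum:
  assumes g: "\<And>i. i \<in> S \<Longrightarrow> 0 \<notin># g i" and "0 \<notin># \<mu>"
  shows "elem_coeff (\<Sum>i\<in>S. scale (c i) (elem_part (g i))) \<mu> = (\<Sum>i\<in>S. if g i = \<mu> then c i else 0)"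
proof -
  have "elem_coeff (\<Sum>i\<in>S. scale (c i) (elem_part (g i))) \<mu>
      = (\<Sum>i\<in>S. series.representation elem_basis (scale (c i) (elem_part (g i))) (elem_part \<mu>))"
    unfolding elem_coeff_def
    by (subst series.representation_sum)
      (auto intro!: independent_elem_basis series.span_scale elem_part_in_span g)
  also have "\<dots> = (\<Sum>i\<in>S. if g i = \<mu> then c i else 0)"
  proof (rule sum.cong)
    fix i assume i: "i \<in> S"
    have "elem_part (g i) \<in> elem_basis"
      using g[OF i] by (simp add: elem_basis_def)
    then show "series.representation elem_basis (scale (c i) (elem_part (g i))) (elem_part \<mu>)
        = (if g i = \<mu> then c i else 0)"
      using inj_onD[OF inj_on_elem_part, of \<mu> "g i"] g[OF i] assms(2)
      by (auto simp: series.representation_scale independent_elem_basis series.span_base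
          series.representation_basis)
  qed simp
  finally show ?thesis .
qed

text \<open>The multiset order is well-founded, so a nonzero difference \<open>a - b\<close> has a
  least monomial. Multiplication by \<open>elem 1\<close> shifts it by the first variable and keeps
  its nonzero coefficient.\<close>

lemma elem_1_mult_cancel:
  assumes "elem 1 * a = elem 1 * b"
  shows "a = b"
proof (rule ccontr)
  assume "a \<noteq> b"
  then have "\<exists>M. coeff (a - b) M \<noteq> 0"
    by (metis series_eqI eq_iff_diff_eq_0 zero_series.rep_eq)
  then obtain M where "coeff (a - b) M \<noteq> 0" "\<And>N. N < M \<Longrightarrow> coeff (a - b) N = 0"
    using exists_least_iff[of "\<lambda>M. coeff (a - b) M \<noteq> 0"] by blast
  then have "least_term (a - b) M (coeff (a - b) M)" "coeff (a - b) M \<noteq> 0"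
    by (auto simp: least_term_def)
  with least_term_mult[OF least_term_elem this(1), of 1] assms show False
    by (simp add: least_term_def right_diff_distrib zero_series.rep_eq)
qed


section \<open>The map from noncommutative to commutative symmetric functions\<close>

lemma parts_Composition: "0 \<notin> set xs \<Longrightarrow> parts (Composition xs) = xs"
  by (simp add: Composition_inverse)

lemma zero_notin_parts: "0 \<notin> set (parts I)"
  using parts[of I] by simp

lemma finite_compositions_of: "finite (compositions_of n)"
proof -
  have "parts ` compositions_of n \<subseteq> {xs. set xs \<subseteq> {..n} \<and> length xs \<le> n}"
  proof clarify
    fix I assume I: "I \<in> compositions_of n"
    have "length xs \<le> sum_list xs" if "0 \<notin> set xs" for xs :: "nat list"
      using that by (induction xs) auto
    then show "set (parts I) \<subseteq> {..n} \<and> length (parts I) \<le> n"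
      using I zero_notin_parts[of I] by (auto simp: compositions_of_def member_le_sum_list)
  qed
  then have "finite (parts ` compositions_of n)"
    using finite_lists_length_le[of "{..n}" n] finite_subset by auto
  then show ?thesis
    by (rule finite_imageD) (simp add: inj_on_def parts_inject)
qed

lemma compositions_of_0: "compositions_of 0 = {0}"
proof -
  have "I = 0" if "sum_list (parts I) = 0" for I
    using that zero_notin_parts[of I]
    by (intro parts_inject[THEN iffD1]) (cases "parts I"; simp add: zero_composition.rep_eq)
  then show ?thesis
    by (auto simp: compositions_of_def zero_composition.rep_eq)
qed

lemma parts_Cons: "1 \<le> i \<Longrightarrow> parts (Composition [i] + J) = i # parts J"
  by (simp add: plus_composition.rep_eq parts_Composition)

text \<open>Cutting off the first part is a bijection; it is the source of all recurrences in
  \<open>n\<close> for sums over compositions.\<close>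

lemma sum_compositions_of_first_part:
  assumes "1 \<le> n"
  shows "(\<Sum>I\<in>compositions_of n. f I) =
    (\<Sum>i=1..n. \<Sum>J\<in>compositions_of (n - i). f (Composition [i] + J))"
proof -
  have nonempty: "parts I \<noteq> []" if "I \<in> compositions_of n" for I
    using that assms by (auto simp: compositions_of_def)
  have tl: "parts (Composition (tl (parts I))) = tl (parts I)" for I
    using zero_notin_parts[of I] by (intro parts_Composition) (cases "parts I"; auto)
  have hd: "1 \<le> hd (parts I)" "hd (parts I) + sum_list (tl (parts I)) = n"
    if "I \<in> compositions_of n" for I
    using nonempty[OF that] zero_notin_parts[of I] that
    by (cases "parts I"; auto simp: compositions_of_def)+
  have "(\<Sum>I\<in>compositions_of n. f I) =
      (\<Sum>(i, J)\<in>Sigma {1..n} (\<lambda>i. compositions_of (n - i)). f (Composition [i] + J))"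
  proof (rule sum.reindex_bij_witness[where i = "\<lambda>(i, J). Composition [i] + J"
        and j = "\<lambda>I. (hd (parts I), Composition (tl (parts I)))"])
    fix I assume I: "I \<in> compositions_of n"
    have eq: "Composition [hd (parts I)] + Composition (tl (parts I)) = I"
      using hd[OF I] nonempty[OF I]
      by (intro parts_inject[THEN iffD1]) (simp add: parts_Cons tl)
    then show "(case (hd (parts I), Composition (tl (parts I))) of (i, J) \<Rightarrow> Composition [i] + J) = I"
      by simp
    show "(case (hd (parts I), Composition (tl (parts I))) of (i, J) \<Rightarrow> f (Composition [i] + J)) = f I"
      by (simp add: eq)
    show "(hd (parts I), Composition (tl (parts I))) \<in> Sigma {1..n} (\<lambda>i. compositions_of (n - i))"
      using hd[OF I] by (auto simp: compositions_of_def tl)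
  qed (auto simp: compositions_of_def parts_Cons parts_inverse)
  then show ?thesis
    by (simp add: sum.Sigma finite_compositions_of)
qed

section \<open>The ring homomorphism from noncommutative symmetric functions to series\<close>

definition elem_comp :: "composition \<Rightarrow> series" where
  "elem_comp I = elem_part (mset (parts I))"

lemma elem_comp_0 [simp]: "elem_comp 0 = 1"
  by (simp add: elem_comp_def elem_part_def zero_composition.rep_eq)

lemma elem_comp_add: "elem_comp (I + J) = elem_comp I * elem_comp J"
  by (simp add: elem_comp_def elem_part_def plus_composition.rep_eq)

lemma elem_comp_Cons: "1 \<le> i \<Longrightarrow> elem_comp (Composition [i] + J) = elem i * elem_comp J"
  by (simp add: elem_comp_def elem_part_def parts_Cons)

definition abelianize :: "nsym \<Rightarrow> series" where
  "abelianize f = (\<Sum>I\<in>Poly_Mapping.keys f. scale (Poly_Mapping.lookup f I) (elem_comp I))"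

text \<open>Lets elements with different supports be compared over a common index set.\<close>

lemma abelianize_superset:
  assumes "finite S" "Poly_Mapping.keys f \<subseteq> S"
  shows "abelianize f = (\<Sum>I\<in>S. scale (Poly_Mapping.lookup f I) (elem_comp I))"
  unfolding abelianize_def
  by (rule sum.mono_neutral_left) (use assms in \<open>auto simp: in_keys_iff\<close>)

lemma abelianize_add: "abelianize (f + g) = abelianize f + abelianize g"
proof -
  let ?S = "Poly_Mapping.keys f \<union> Poly_Mapping.keys g"
  have "Poly_Mapping.keys (f + g) \<subseteq> ?S"
    by (rule Poly_Mapping.keys_add)
  then show ?thesis
    by (simp add: abelianize_superset[of ?S] lookup_add series.scale_left_distrib sum.distrib)
qed

lemma abelianize_0 [simp]: "abelianize 0 = 0"
  by (simp add: abelianize_def)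

lemma abelianize_diff: "abelianize (f - g) = abelianize f - abelianize g"
  by (metis abelianize_add add_diff_cancel_right' diff_add_cancel)

lemma abelianize_sum: "abelianize (sum f S) = (\<Sum>i\<in>S. abelianize (f i))"
  by (induction S rule: infinite_finite_induct) (simp_all add: abelianize_add)

lemma abelianize_single: "abelianize (Poly_Mapping.single I c) = scale c (elem_comp I)"
  by (simp add: abelianize_def)

lemma of_int_mult_Lambda_comp: "of_int z * Lambda_comp I = Poly_Mapping.single I (of_int z)"
  by (simp add: Lambda_comp_eq_single mult_single flip: single_of_int)

lemma nsym_eq_sum_single:
  "f = (\<Sum>I\<in>Poly_Mapping.keys f. Poly_Mapping.single I (Poly_Mapping.lookup f I))" for f :: nsym
  using nsym_expansion[of f] by (simp add: Lambda_comp_eq_single mult_single)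

text \<open>Bilinearity reduces the claim to basis elements, where concatenation goes to the product
  of series.\<close>

lemma abelianize_mult: "abelianize (f * g) = abelianize f * abelianize g"
proof -
  have "abelianize (f * g) = (\<Sum>I\<in>Poly_Mapping.keys f. \<Sum>J\<in>Poly_Mapping.keys g.
      abelianize (Poly_Mapping.single I (Poly_Mapping.lookup f I) *
        Poly_Mapping.single J (Poly_Mapping.lookup g J)))"
    by (subst (1) nsym_eq_sum_single[of f], subst (1) nsym_eq_sum_single[of g])
      (simp only: sum_product abelianize_sum)
  also have "\<dots> = abelianize f * abelianize g"
    by (simp add: mult_single abelianize_single elem_comp_add scale_mult_scale
        abelianize_def[of f] abelianize_def[of g] sum_product)
  finally show ?thesis .
qed

text \<open>The coefficient at \<open>\<mu>\<close> is the sum of the coefficients of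
  \<open>f\<close> over the compositions that rearrange to \<open>\<mu>\<close>.\<close>

lemma e_positive_abelianize:
  assumes "Lambda_positive f"
  shows "e_positive (abelianize f)"
  unfolding e_positive_def
proof (intro conjI allI impI)
  show "abelianize f \<in> series.span elem_basis"
    unfolding abelianize_def elem_comp_def
    by (intro series.span_sum series.span_scale elem_part_in_span) (simp add: zero_notin_parts)
  fix \<mu> :: "nat multiset" assume "0 \<notin># \<mu>"
  then show "0 \<le> elem_coeff (abelianize f) \<mu>"
    unfolding abelianize_def elem_comp_def using assms
    by (subst elem_coeff_sum) (auto simp: zero_notin_parts Lambda_positive_def intro!: sum_nonneg)
qed


section \<open>Positivity in the noncommutative setting\<close>

lemma path_weight_nonneg: "0 \<le> path_weight I"
proof -
  have "0 \<le> (\<Prod>j\<leftarrow>is. int j - 1)" if "0 \<notin> set is" for "is"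
    using that by (induction "is") auto
  then show ?thesis
    using zero_notin_parts[of I] by (auto simp: path_weight_def split: list.split)
qed

text \<open>Since \<open>I\<close> is nonempty, the exceptional first factor belongs to
  \<open>I\<close>, and every part of \<open>J\<close> is weighted as in
  \<open>A_nc\<close>.\<close>

lemma path_weight_add:
  assumes "I \<noteq> 0"
  shows "path_weight (I + J) = path_weight I * (\<Prod>j\<leftarrow>parts J. int j - 1)"
  using assms
  by (auto simp: path_weight_def plus_composition.rep_eq zero_composition.rep_eq
      simp flip: parts_inject split: list.split)

text \<open>Parts are positive, so at most one prefix of a composition has sum \<open>a\<close>; the
  place of the cut is determined.\<close>

lemma inj_on_add_compositions_of:
  "inj_on (\<lambda>(I, J). I + J) (compositions_of a \<times> compositions_of b)"
proof -
  have split_unique: "xs = xs' \<and> ys = ys'"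
    if "xs @ ys = xs' @ ys'" "sum_list xs = sum_list xs'" "0 \<notin> set (xs @ ys)" "0 \<notin> set (xs' @ ys')"
    for xs ys xs' ys' :: "nat list"
    using that
  proof (induction xs arbitrary: xs')
    case Nil
    then show ?case by (cases xs') auto
  next
    case (Cons x xs)
    then show ?case by (cases xs') auto
  qed
  show ?thesis
  proof (rule inj_onI, clarify)
    fix I J I' J'
    assume "I \<in> compositions_of a" "I' \<in> compositions_of a" and eq: "I + J = I' + J'"
    then show "I = I' \<and> J = J'"
      using split_unique[of "parts I" "parts J" "parts I'" "parts J'"]
        arg_cong[OF eq, of parts, unfolded plus_composition.rep_eq] zero_notin_parts[of I] zero_notin_parts[of J]
        zero_notin_parts[of I'] zero_notin_parts[of J']
      by (auto simp: compositions_of_def parts_inject)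
  qed
qed

lemma Lambda_positive_D_nc:
  assumes "1 \<le> k" "k \<le> n - 1"
  shows "Lambda_positive (D_nc n k)"
proof -
  \<comment> \<open>\<open>T\<close> consists of the compositions of \<open>n\<close> that have
    \<open>n - k\<close> among their partial sums.\<close>
  define T where "T = (\<lambda>(I, J). I + J) ` (compositions_of (n - k) \<times> compositions_of k)"
  define mon where "mon I = (Poly_Mapping.single I (of_int (path_weight I)) :: nsym)" for I
  have T: "T \<subseteq> compositions_of n"
    using assms by (auto simp: T_def compositions_of_def plus_composition.rep_eq)
  \<comment> \<open>Here \<open>n - k\<close> is at least 1, so the left factor is nonempty and
    \<open>path_weight_add\<close> applies.\<close>
  have "I \<noteq> 0" if "I \<in> compositions_of (n - k)" for I
    using that assms by (auto simp: compositions_of_def zero_composition.rep_eq)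
  then have "X_path_nc (n - k) * A_nc k =
      (\<Sum>p\<in>compositions_of (n - k) \<times> compositions_of k. mon (case p of (I, J) \<Rightarrow> I + J))"
    by (auto simp: X_path_nc_def A_nc_def mon_def of_int_mult_Lambda_comp sum_product
        mult_single path_weight_add sum.cartesian_product intro!: sum.cong)
  also have "\<dots> = sum mon T"
    unfolding T_def by (simp add: sum.reindex[OF inj_on_add_compositions_of])
  finally have "D_nc n k = sum mon (compositions_of n) - sum mon T"
    by (simp add: D_nc_def X_path_nc_def mon_def of_int_mult_Lambda_comp)
  also have "\<dots> = sum mon (compositions_of n - T)"
    using T finite_compositions_of by (simp add: sum_diff)
  finally show ?thesis
    by (auto simp: Lambda_positive_def lookup_sum mon_def lookup_single when_def
        path_weight_nonneg intro!: sum_nonneg)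
qed


section \<open>Generating series of weighted sets\<close>

text \<open>Only meaningful when all fibres of \<open>wt\<close> on \<open>T\<close> are finite, since \<open>card\<close> is \<open>0\<close> on infinite
  sets.\<close>

definition weight_series :: "('a \<Rightarrow> nat multiset) \<Rightarrow> 'a set \<Rightarrow> series" where
  "weight_series wt T = Series (\<lambda>M. of_nat (card {t \<in> T. wt t = M}))"

lemma product_fibre:
  "{p \<in> T \<times> U. (case p of (t, u) \<Rightarrow> f t + g u) = M} =
    (\<Union>(A, B)\<in>{(A, B). A + B = M}. {t \<in> T. f t = A} \<times> {u \<in> U. g u = B})"
  by auto

lemma finite_product_fibre:
  assumes "\<And>M. finite {t \<in> T. f t = M}" "\<And>M. finite {u \<in> U. g u = M}"
  shows "finite {p \<in> T \<times> U. (case p of (t, u) \<Rightarrow> f t + g u) = (M :: 'a multiset)}"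
  unfolding product_fibre
  by (rule finite_UN_I) (auto simp: finite_splittings assms)

text \<open>The fibre over \<open>M\<close> is the disjoint union, over the splittings of
  \<open>M\<close>, of products of fibres: this is the Cauchy product.\<close>

lemma weight_series_mult:
  assumes "\<And>M. finite {t \<in> T. f t = M}" "\<And>M. finite {u \<in> U. g u = M}"
  shows "weight_series f T * weight_series g U = weight_series (\<lambda>(t, u). f t + g u) (T \<times> U)"
proof (rule series_eqI)
  fix M
  have "card {p \<in> T \<times> U. (case p of (t, u) \<Rightarrow> f t + g u) = M} =
      (\<Sum>(A, B)\<in>{(A, B). A + B = M}. card {t \<in> T. f t = A} * card {u \<in> U. g u = B})"
    unfolding product_fibre
    by (subst card_UN_disjoint)
      (auto simp: finite_splittings assms card_cartesian_product case_prod_beta)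
  then show "coeff (weight_series f T * weight_series g U) M =
      coeff (weight_series (\<lambda>(t, u). f t + g u) (T \<times> U)) M"
    by (simp add: weight_series_def times_series.rep_eq case_prod_unfold)
qed

lemma weight_series_UN:
  assumes "finite I" "\<And>i M. i \<in> I \<Longrightarrow> finite {t \<in> T i. f t = M}"
    and "\<And>i j. i \<in> I \<Longrightarrow> j \<in> I \<Longrightarrow> i \<noteq> j \<Longrightarrow> T i \<inter> T j = {}"
  shows "(\<Sum>i\<in>I. weight_series f (T i)) = weight_series f (\<Union>i\<in>I. T i)"
proof (rule series_eqI)
  fix M
  have "{t \<in> (\<Union>i\<in>I. T i). f t = M} = (\<Union>i\<in>I. {t \<in> T i. f t = M})"
    by auto
  also have "card \<dots> = (\<Sum>i\<in>I. card {t \<in> T i. f t = M})"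
    using assms by (intro card_UN_disjoint) blast+
  finally show "coeff (\<Sum>i\<in>I. weight_series f (T i)) M = coeff (weight_series f (\<Union>i\<in>I. T i)) M"
    by (simp add: weight_series_def coeff_sum)
qed

lemma weight_series_Un:
  assumes "\<And>M. finite {t \<in> T \<union> U. f t = M}" "T \<inter> U = {}"
  shows "weight_series f (T \<union> U) = weight_series f T + weight_series f U"
proof (rule series_eqI)
  fix M
  have fibre: "{t \<in> T \<union> U. f t = M} = {t \<in> T. f t = M} \<union> {t \<in> U. f t = M}"
    by auto
  have "card {t \<in> T \<union> U. f t = M} = card {t \<in> T. f t = M} + card {t \<in> U. f t = M}"
    using assms(1)[of M] assms(2) unfolding fibre finite_Un by (intro card_Un_disjoint) auto
  then show "coeff (weight_series f (T \<union> U)) M = coeff (weight_series f T + weight_series f U) M"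
    by (simp add: weight_series_def plus_series.rep_eq)
qed

lemma weight_series_bij:
  assumes "bij_betw h T U" "\<And>t. t \<in> T \<Longrightarrow> g (h t) = f t"
  shows "weight_series f T = weight_series g U"
proof (rule series_eqI)
  fix M
  have "bij_betw h {t \<in> T. f t = M} {u \<in> U. g u = M}"
    using assms by (auto simp: bij_betw_def inj_on_def)
  then show "coeff (weight_series f T) M = coeff (weight_series g U) M"
    by (simp add: weight_series_def bij_betw_same_card)
qed

text \<open>Marking one of the \<open>i\<close> elements of a color set will produce the factor in
  \<open>of_nat i * elem i\<close>.\<close>

lemma weight_series_Sigma:
  assumes "\<And>M. finite {t \<in> T. f t = M}" "\<And>t. t \<in> T \<Longrightarrow> finite (F t) \<and> card (F t) = n"
  shows "weight_series (\<lambda>(t, u). f t) (Sigma T F) = of_nat n * weight_series f T"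
proof (rule series_eqI)
  fix M
  have "{p \<in> Sigma T F. (case p of (t, u) \<Rightarrow> f t) = M} = Sigma {t \<in> T. f t = M} F"
    by auto
  also have "card \<dots> = n * card {t \<in> T. f t = M}"
    using assms by (simp add: card_SigmaI)
  finally show "coeff (weight_series (\<lambda>(t, u). f t) (Sigma T F)) M =
      coeff (of_nat n * weight_series f T) M"
    by (simp add: weight_series_def scale.rep_eq flip: scale_of_nat)
qed


section \<open>Path colorings as words\<close>

definition color_sets :: "nat \<Rightarrow> nat set set" where
  "color_sets i = {S. finite S \<and> S \<subseteq> {1..} \<and> card S = i}"

definition color_words :: "nat \<Rightarrow> nat list set" where
  "color_words n = {w. length w = n \<and> set w \<subseteq> {1..} \<and> distinct_adj w}"

lemma finite_color_sets_fibre: "finite {S \<in> color_sets i. mset_set S = M}"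
proof -
  have "{S \<in> color_sets i. mset_set S = M} \<subseteq> {set_mset M}"
    by (auto simp: color_sets_def)
  then show ?thesis by (rule finite_subset) simp
qed

lemma finite_color_words_fibre: "finite {w \<in> color_words n. mset w = M}"
proof -
  obtain v where "mset v = M" by (metis ex_mset)
  then show ?thesis
    using finite_subset[OF _ mset_eq_finite[of v]] by (simp add: Collect_mono)
qed

lemma elem_eq_weight_series: "elem i = weight_series mset_set (color_sets i)"
proof (rule series_eqI)
  fix M
  have "{S \<in> color_sets i. mset_set S = M} = (if M \<in> mset_set ` color_sets i then {set_mset M} else {})"
    by (auto simp: color_sets_def)
  then show "coeff (elem i) M = coeff (weight_series mset_set (color_sets i)) M"
    by (simp add: elem_def weight_series_def color_sets_def)
qed

text \<open>A coloring is read as a word along the path, vertex \<open>i + 1\<close> giving letter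
  \<open>i\<close>; properness becomes distinctness of neighbouring letters.\<close>

lemma X_path_eq_weight_series: "X_path n = weight_series mset (color_words n)"
proof -
  define E where "E = {{i, i + 1} | i. 1 \<le> i \<and> i < n}"
  have adj: "(\<forall>u v. {u, v} \<in> E \<longrightarrow> c u \<noteq> c v) \<longleftrightarrow> (\<forall>i. Suc i < n \<longrightarrow> c (Suc i) \<noteq> c (Suc (Suc i)))"
    for c :: "nat \<Rightarrow> nat"
  proof
    assume *: "\<forall>u v. {u, v} \<in> E \<longrightarrow> c u \<noteq> c v"
    have "{Suc i, Suc (Suc i)} \<in> E" if "Suc i < n" for i
      using that unfolding E_def by (intro CollectI exI[of _ "Suc i"]) simp
    with * show "\<forall>i. Suc i < n \<longrightarrow> c (Suc i) \<noteq> c (Suc (Suc i))"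
      by blast
  next
    assume *: "\<forall>i. Suc i < n \<longrightarrow> c (Suc i) \<noteq> c (Suc (Suc i))"
    have "c u \<noteq> c v" if uv: "{u, v} \<in> E" for u v
    proof -
      obtain i where i: "{u, v} = {i, i + 1}" "1 \<le> i" "i < n"
        using uv unfolding E_def by blast
      then have "c i \<noteq> c (i + 1)"
        using *[rule_format, of "i - 1"] by simp
      with i(1) show ?thesis
        by (auto simp: doubleton_eq_iff)
    qed
    then show "\<forall>u v. {u, v} \<in> E \<longrightarrow> c u \<noteq> c v"
      by blast
  qed
  let ?h = "\<lambda>c. map (\<lambda>i. c (Suc i)) [0..<n]"
  \<comment> \<open>The restriction to \<open>{1..n}\<close> makes the inverse land in the
    extensional colorings.\<close>
  let ?g = "\<lambda>w. \<lambda>i\<in>{1..n}. w ! (i - 1)"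
  have "bij_betw ?h (proper_colorings {1..n} E) (color_words n)"
  proof (rule bij_betw_byWitness[where f' = ?g])
    show "\<forall>c\<in>proper_colorings {1..n} E. ?g (?h c) = c"
    proof (intro ballI ext)
      fix c i assume "c \<in> proper_colorings {1..n} E"
      then show "?g (?h c) i = c i"
        by (auto simp: proper_colorings_def PiE_def extensional_def)
    qed
    show "\<forall>w\<in>color_words n. ?h (?g w) = w"
      by (auto simp: color_words_def intro!: nth_equalityI)
    show "?h ` proper_colorings {1..n} E \<subseteq> color_words n"
      by (auto simp: proper_colorings_def color_words_def adj distinct_adj_conv_nth PiE_def Pi_def)
    show "?g ` color_words n \<subseteq> proper_colorings {1..n} E"
      by (auto simp: proper_colorings_def color_words_def adj distinct_adj_conv_nth PiE_def Pi_def
          subset_iff)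
  qed
  moreover have "mset (?h c) = image_mset c (mset_set {1..n})" for c
  proof -
    have "map (\<lambda>i. c (Suc i)) [0..<n] = map c [Suc 0..<Suc n]"
      by (simp only: map_Suc_upt[symmetric] map_map o_def)
    then show ?thesis
      by (simp only: mset_map mset_upt atLeastLessThanSuc_atLeastAtMost One_nat_def)
  qed
  ultimately show ?thesis
    unfolding X_path_def chromatic_def E_def[symmetric]
    by (subst weight_series_bij[symmetric, where h = ?h]) (auto simp: weight_series_def)
qed

text \<open>Weighted by all colors used, these pairs are counted by the sum of
  \<open>elem i * X_path (n - i)\<close>; the marked pairs below carry the additional factor
  \<open>of_nat i\<close>.\<close>

definition set_word_pairs :: "nat \<Rightarrow> (nat set \<times> nat list) set" where
  "set_word_pairs n = (\<Union>i\<le>n. color_sets i \<times> color_words (n - i))"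

definition marked_pairs :: "nat \<Rightarrow> ((nat set \<times> nat) \<times> nat list) set" where
  "marked_pairs n = (\<Union>i\<le>n. Sigma (color_sets i) (\<lambda>S. S) \<times> color_words (n - i))"

text \<open>If the marked element \<open>s\<close> of \<open>S\<close> is not the first letter of \<open>w\<close>, move it to the front of
  \<open>w\<close>; otherwise only forget the mark.  The two cases are told apart afterwards by whether the
  first letter lies in the set.\<close>

lemma bij_betw_marked_pairs:
  "bij_betw (\<lambda>((S, s), w). if w \<noteq> [] \<and> hd w = s then (S, w) else (S - {s}, s # w))
    (marked_pairs n) {(S, w) \<in> set_word_pairs n. w \<noteq> []}"
proof -
  \<comment> \<open>Moving a letter keeps the total size \<open>n\<close>: the set loses one element
    and the word gains one letter.\<close>
  have "Suc (n - card S) = n - (card S - Suc 0)" if "s \<in> S" "finite S" "card S \<le> n" for S and s :: nat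
    using that card_gt_0_iff[of S] by auto
  then show ?thesis
    by (intro bij_betw_byWitness[where f' = "\<lambda>(S, w). if hd w \<in> S then ((S, hd w), w)
          else ((insert (hd w) S, hd w), tl w)"])
      (auto simp: marked_pairs_def set_word_pairs_def color_sets_def color_words_def
        distinct_adj_Cons neq_Nil_conv split: if_splits)
qed

text \<open>The pairs on the left are split by whether the word is empty. Empty words leave
  \<open>elem n\<close>, and the other pairs correspond to the marked pairs.\<close>

lemma X_path_elem_recurrence:
  "(\<Sum>i\<le>n. elem i * X_path (n - i)) = elem n + (\<Sum>i\<le>n. of_nat i * elem i * X_path (n - i))"
proof -
  let ?wt = "\<lambda>(S, w). mset_set S + mset w" and ?mwt = "\<lambda>((S, s), w). mset_set S + mset w"
  let ?P = "set_word_pairs n"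
  note fibres = finite_color_sets_fibre finite_color_words_fibre
  have fin: "finite {p \<in> color_sets i \<times> color_words j. ?wt p = M}" for i j M
    by (intro finite_product_fibre fibres)
  have fin_P: "finite {p \<in> ?P. ?wt p = M}" for M
  proof -
    have "{p \<in> ?P. ?wt p = M} = (\<Union>i\<le>n. {p \<in> color_sets i \<times> color_words (n - i). ?wt p = M})"
      by (auto simp: set_word_pairs_def)
    then show ?thesis using fin by simp
  qed
  have fin_marked: "finite {q \<in> Sigma (color_sets i) (\<lambda>S. S). (case q of (S, s) \<Rightarrow> mset_set S) = M}"
    for i M
  proof -
    have "{q \<in> Sigma (color_sets i) (\<lambda>S. S). (case q of (S, s) \<Rightarrow> mset_set S) = M} =
        Sigma {S \<in> color_sets i. mset_set S = M} (\<lambda>S. S)"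
      by auto
    also have "finite \<dots>"
      by (intro finite_SigmaI fibres) (simp add: color_sets_def)
    finally show ?thesis .
  qed
  have mwt: "?mwt = (\<lambda>(q, w). (case q of (S, s) \<Rightarrow> mset_set S) + mset w)"
    by auto
  have fin_mwt: "finite {p \<in> Sigma (color_sets i) (\<lambda>S. S) \<times> color_words j. ?mwt p = M}" for i j M
    unfolding mwt by (intro finite_product_fibre fin_marked fibres)

  have "(\<Sum>i\<le>n. elem i * X_path (n - i)) =
      (\<Sum>i\<le>n. weight_series ?wt (color_sets i \<times> color_words (n - i)))"
    by (simp add: elem_eq_weight_series X_path_eq_weight_series weight_series_mult fibres)
  also have "\<dots> = weight_series ?wt ?P"
    unfolding set_word_pairs_def
    by (rule weight_series_UN[OF _ fin]) (auto simp: color_sets_def)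
  also have "?P = {(S, w) \<in> ?P. w = []} \<union> {(S, w) \<in> ?P. w \<noteq> []}"
    by auto
  also have "weight_series ?wt \<dots> =
      weight_series ?wt {(S, w) \<in> ?P. w = []} + weight_series ?wt {(S, w) \<in> ?P. w \<noteq> []}"
    by (intro weight_series_Un finite_subset[OF _ fin_P]) auto
  \<comment> \<open>An empty word forces the set to have all \<open>n\<close> elements.\<close>
  also have "weight_series ?wt {(S, w) \<in> ?P. w = []} = weight_series mset_set (color_sets n)"
    by (rule weight_series_bij[symmetric, where h = "\<lambda>S. (S, [])"])
      (auto simp: set_word_pairs_def color_words_def color_sets_def bij_betw_def inj_on_def)
  also have "weight_series ?wt {(S, w) \<in> ?P. w \<noteq> []} = weight_series ?mwt (marked_pairs n)"
    by (rule weight_series_bij[OF bij_betw_marked_pairs, symmetric])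
      (auto simp: marked_pairs_def color_sets_def mset_set.remove)
  also have "\<dots> = (\<Sum>i\<le>n. weight_series ?mwt (Sigma (color_sets i) (\<lambda>S. S) \<times> color_words (n - i)))"
    unfolding marked_pairs_def
    by (rule weight_series_UN[OF _ fin_mwt, symmetric]) (auto simp: color_sets_def)
  also have "\<dots> = (\<Sum>i\<le>n. of_nat i * elem i * X_path (n - i))"
  proof (rule sum.cong)
    fix i
    have "of_nat i * elem i = weight_series (\<lambda>(S, s). mset_set S) (Sigma (color_sets i) (\<lambda>S. S))"
      unfolding elem_eq_weight_series
      by (rule weight_series_Sigma[OF fibres(1), symmetric]) (simp add: color_sets_def)
    then show "weight_series ?mwt (Sigma (color_sets i) (\<lambda>S. S) \<times> color_words (n - i)) =
        of_nat i * elem i * X_path (n - i)"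
      by (simp only: mwt X_path_eq_weight_series weight_series_mult fin_marked fibres)
  qed simp
  finally show ?thesis
    by (simp add: elem_eq_weight_series)
qed


section \<open>Expansion in the elementary basis\<close>

lemma elem_0: "elem 0 = 1"
proof -
  have "{S. finite S \<and> S \<subseteq> {1..} \<and> card S = 0} = {{} :: nat set}"
    by auto
  then show ?thesis
    by (intro series_eqI) (simp add: elem_def one_series.rep_eq del: atLeast_iff)
qed

section \<open>Recurrences and the identification of the path series\<close>

lemma abelianize_X_path_nc:
  "abelianize (X_path_nc n) = (\<Sum>I\<in>compositions_of n. of_int (path_weight I) * elem_comp I)"
  by (simp add: X_path_nc_def abelianize_sum of_int_mult_Lambda_comp abelianize_single scale_of_int)

lemma abelianize_A_nc:
  "abelianize (A_nc n) =
    (\<Sum>I\<in>compositions_of n. of_int (\<Prod>i\<leftarrow>parts I. int i - 1) * elem_comp I)"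
  by (simp add: A_nc_def abelianize_sum of_int_mult_Lambda_comp abelianize_single scale_of_int)

text \<open>Only the first part carries the exceptional factor \<open>i\<close>; the remaining parts
  are weighted as in \<open>A_nc\<close>.\<close>

lemma abelianize_X_path_nc_first_part:
  assumes "1 \<le> n"
  shows "abelianize (X_path_nc n) = (\<Sum>i=1..n. of_nat i * elem i * abelianize (A_nc (n - i)))"
  unfolding abelianize_X_path_nc abelianize_A_nc sum_compositions_of_first_part[OF assms]
  by (intro sum.cong refl)
    (simp add: path_weight_def parts_Cons elem_comp_Cons sum_distrib_left mult.assoc mult.left_commute)

lemma abelianize_A_nc_first_part:
  assumes "1 \<le> n"
  shows "abelianize (A_nc n) = (\<Sum>i=1..n. (of_nat i - 1) * elem i * abelianize (A_nc (n - i)))"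
  unfolding abelianize_A_nc sum_compositions_of_first_part[OF assms]
  by (intro sum.cong refl)
    (simp add: parts_Cons elem_comp_Cons sum_distrib_left mult.assoc mult.left_commute)

lemma abelianize_degree_0: "abelianize (A_nc 0) = 1" "abelianize (X_path_nc 0) = 1"
  by (simp_all add: abelianize_A_nc abelianize_X_path_nc compositions_of_0 path_weight_def
      zero_composition.rep_eq)

lemma sum_atMost_split_0: "(\<Sum>i\<le>n. f i) = f 0 + (\<Sum>i=1..n. f i)" for f :: "nat \<Rightarrow> 'a::comm_monoid_add"
  by (simp add: sum.atLeast_Suc_atMost flip: atLeast0AtMost)

text \<open>With \<open>E = \<Sum> e\<^sub>i t\<^sup>i\<close>, \<open>G = \<Sum> (1 - i) e\<^sub>i t\<^sup>i\<close>, the recurrences say \<open>G A = 1\<close> and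
  \<open>X\<^sub>n\<^sub>c = E A\<close>, while \<open>G X = E\<close>.\<close>

lemma X_path_eq_abelianize: "X_path n = abelianize (X_path_nc n)"
proof -
  define X where "X = Abs_fps X_path"
  define Y where "Y = Abs_fps (\<lambda>n. abelianize (X_path_nc n))"
  define A where "A = Abs_fps (\<lambda>n. abelianize (A_nc n))"
  define E where "E = Abs_fps elem"
  define G where "G = Abs_fps (\<lambda>i. (1 - of_nat i) * elem i)"
  have "G * X = E"
  proof (rule fps_ext)
    fix n
    show "fps_nth (G * X) n = fps_nth E n"
      using X_path_elem_recurrence[of n]
      by (simp add: G_def X_def E_def fps_mult_nth atLeast0AtMost left_diff_distrib sum_subtractf)
  qed
  moreover have "G * A = 1"
  proof (rule fps_ext)
    fix n
    show "fps_nth (G * A) n = fps_nth 1 n"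
    proof (cases "n = 0")
      case True
      then show ?thesis
        by (simp add: G_def A_def abelianize_degree_0 elem_0)
    next
      case False
      then show ?thesis
        using abelianize_A_nc_first_part[of n]
        by (simp add: G_def A_def fps_mult_nth atLeast0AtMost sum_atMost_split_0 elem_0
            left_diff_distrib sum_subtractf)
    qed
  qed
  moreover have "Y = E * A"
  proof (rule fps_ext)
    fix n
    show "fps_nth Y n = fps_nth (E * A) n"
    proof (cases "n = 0")
      case True
      then show ?thesis
        by (simp add: Y_def E_def A_def abelianize_degree_0 elem_0)
    next
      case False
      \<comment> \<open>The difference of the two recurrences is the sum of
        \<open>elem i * abelianize (A_nc (n - i))\<close> over positive \<open>i\<close>; the
        missing term for \<open>i = 0\<close> is \<open>abelianize (A_nc n)\<close>, as
        \<open>elem 0 = 1\<close>.\<close>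
      then show ?thesis
        using abelianize_A_nc_first_part[of n] abelianize_X_path_nc_first_part[of n]
        by (simp add: Y_def E_def A_def fps_mult_nth atLeast0AtMost sum_atMost_split_0 elem_0
            left_diff_distrib sum_subtractf)
    qed
  qed
  \<comment> \<open>Indeed \<open>X = (G * A) * X = (G * X) * A = E * A = Y\<close>.\<close>
  ultimately have "X = Y"
    by (metis mult.assoc mult.commute mult_1)
  then show ?thesis
    by (simp add: X_def Y_def fps_eq_iff)
qed

section \<open>The parts of the path series with and without \<open>elem 1\<close>\<close>

lemma finite_partitions_of: "finite (partitions_of m)"
proof -
  have "\<mu> \<in> (\<lambda>I. mset (parts I)) ` compositions_of m" if "\<mu> \<in> partitions_of m" for \<mu>
  proof -
    obtain xs where "mset xs = \<mu>" by (metis ex_mset)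
    with that show ?thesis
      by (intro image_eqI[where x = "Composition xs"])
        (auto simp: partitions_of_def compositions_of_def parts_Composition sum_mset_sum_list)
  qed
  then show ?thesis
    using finite_compositions_of finite_surj subsetI by metis
qed

text \<open>Containing a part 1 depends only on the underlying partition, so the sum over partitions
  can be regrouped from the expansion over compositions.\<close>

lemma B_path_eq:
  "B_path m =
    (\<Sum>I\<in>{I \<in> compositions_of m. 1 \<notin> set (parts I)}. of_int (path_weight I) * elem_comp I)"
proof -
  let ?C = "{I \<in> compositions_of m. 1 \<notin> set (parts I)}"
  let ?P = "{\<mu> \<in> partitions_of m. 1 \<notin># \<mu>}"
  have X: "X_path m =
      (\<Sum>I\<in>compositions_of m. scale (of_int (path_weight I)) (elem_part (mset (parts I))))"
    by (simp add: X_path_eq_abelianize abelianize_X_path_nc scale_of_int elem_comp_def)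
  have "scale (elem_coeff (X_path m) \<mu>) (elem_part \<mu>) =
      (\<Sum>I\<in>{I \<in> ?C. mset (parts I) = \<mu>}. of_int (path_weight I) * elem_comp I)"
    if \<mu>: "\<mu> \<in> ?P" for \<mu>
  proof -
    have "elem_coeff (X_path m) \<mu> =
        (\<Sum>I\<in>compositions_of m. if mset (parts I) = \<mu> then of_int (path_weight I) else 0)"
      unfolding X using \<mu> by (intro elem_coeff_sum) (auto simp: zero_notin_parts partitions_of_def)
    also have "\<dots> = (\<Sum>I\<in>{I \<in> ?C. mset (parts I) = \<mu>}. of_int (path_weight I))"
      using \<mu> finite_compositions_of by (intro sum.mono_neutral_cong_right) auto
    finally show ?thesis
      by (simp add: series.scale_sum_left scale_of_int elem_comp_def)
  qed
  then have "B_path m =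
      (\<Sum>\<mu>\<in>?P. \<Sum>I\<in>{I \<in> ?C. mset (parts I) = \<mu>}. of_int (path_weight I) * elem_comp I)"
    unfolding B_path_def by (rule sum.cong[OF refl])
  also have "\<dots> = (\<Sum>I\<in>?C. of_int (path_weight I) * elem_comp I)"
    by (rule sum.group)
      (simp_all add: finite_compositions_of finite_partitions_of,
        auto simp: partitions_of_def compositions_of_def zero_notin_parts sum_mset_sum_list)
  finally show ?thesis .
qed

text \<open>A part \<open>1\<close> that is not the first part makes the weight vanish, so the compositions with a
  part \<open>1\<close> contribute exactly \<open>e\<^sub>1 A\<^sub>k\<close>.\<close>

lemma X_path_Suc_eq: "X_path (k + 1) = elem 1 * abelianize (A_nc k) + B_path (k + 1)"
proof -
  let ?f = "\<lambda>I. of_int (path_weight I) * elem_comp I"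
  let ?g = "\<lambda>I. if 1 \<in> set (parts I) then ?f I else 0"
  have "X_path (k + 1) = (\<Sum>I\<in>compositions_of (k + 1). ?g I) + B_path (k + 1)"
    unfolding X_path_eq_abelianize abelianize_X_path_nc B_path_eq
    by (subst sum.inter_filter[OF finite_compositions_of], subst sum.distrib[symmetric])
      (auto intro!: sum.cong)
  also have "(\<Sum>I\<in>compositions_of (k + 1). ?g I) =
      (\<Sum>i=1..k + 1. \<Sum>J\<in>compositions_of (k + 1 - i). ?g (Composition [i] + J))"
    by (rule sum_compositions_of_first_part) simp
  also have "\<dots> = (\<Sum>i\<in>{1}. \<Sum>J\<in>compositions_of (k + 1 - i). ?g (Composition [i] + J))"
  proof (rule sum.mono_neutral_right)
    have "(\<Prod>j\<leftarrow>is. int j - 1) = 0" if "1 \<in> set is" for "is"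
      using that by (induction "is") auto
    then have "?g (Composition [i] + J) = 0" if "i \<in> {1..k + 1} - {1}" for i J
      using that by (auto simp: parts_Cons path_weight_def)
    then show "\<forall>i\<in>{1..k + 1} - {1}. (\<Sum>J\<in>compositions_of (k + 1 - i). ?g (Composition [i] + J)) = 0"
      by (simp add: sum.neutral)
  qed auto
  \<comment> \<open>A first part 1 has weight factor 1 and leaves a composition of
    \<open>k\<close>.\<close>
  also have "\<dots> = elem 1 * abelianize (A_nc k)"
    by (auto simp: parts_Cons path_weight_def elem_comp_Cons abelianize_A_nc sum_distrib_left mult_ac
        intro!: sum.cong)
  finally show ?thesis .
qed

text \<open>The definite description requires uniqueness as well as existence; uniqueness is the
  cancellation of \<open>elem 1\<close>.\<close>

lemma A_path_eq_abelianize: "A_path k = abelianize (A_nc k)"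
  unfolding A_path_def
proof (rule the_equality)
  show "X_path (k + 1) = elem 1 * abelianize (A_nc k) + B_path (k + 1)"
    by (rule X_path_Suc_eq)
  show "a = abelianize (A_nc k)" if "X_path (k + 1) = elem 1 * a + B_path (k + 1)" for a
    using that X_path_Suc_eq[of k] by (simp add: elem_1_mult_cancel)
qed

theorem theorem3p6:
  fixes n k :: nat
  assumes "1 \<le> k" and "k \<le> n - 1"
  shows "Lambda_positive (D_nc n k) \<and> e_positive (D_path n k)"
proof -
  have "D_path n k = abelianize (D_nc n k)"
    by (simp add: D_path_def D_nc_def abelianize_diff abelianize_mult X_path_eq_abelianize
        A_path_eq_abelianize)
  with Lambda_positive_D_nc[OF assms] show ?thesis
    by (simp add: e_positive_abelianize)
qed

end
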